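(* Let $\nu>0$ and $\theta\in(0,\infty)$. Let $X$ and $Y$ be independent discrete random variables with values in $\{0,1,2,\dots\}$ and probability mass functions $f(x)=P(X=x)>0$ and $g(y)=P(Y=y)>0$ for all $x,y\in\{0,1,2,\dots\}$. Suppose that for all $x,y\in\{0,1,2,\dots\}$ the conditional probability $P(X=x\mid X+Y=x+y)$ is that of the COM-binomial distribution with parameters $(x+y,\frac{1}{\theta+1},\nu)$, i.e. $$P(X=x\mid X+Y=x+y)=\frac{\binom{x+y}{x}^{\nu}\left(\frac{1}{\theta+1}\right)^{x}\left(\frac{\theta}{\theta+1}\right)^{y}}{\sum_{i=0}^{x+y}\binom{x+y}{i}^{\nu}\left(\frac{1}{\theta+1}\right)^{i}\left(\frac{\theta}{\theta+1}\right)^{x+y-i}}.$$ Then there is $\lambda>0$ such that $X\sim\mathrm{CMP}(\lambda,\nu)$ and $Y\sim\mathrm{CMP}(\theta\lambda,\nu)$.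
   Context: For $\lambda,\nu>0$, $X\sim\mathrm{CMP}(\lambda,\nu)$ (COM-Poisson distribution) means $P(X=k)=\frac{\lambda^k}{(k!)^\nu}\cdot\frac{1}{Z(\lambda,\nu)}$ for $k=0,1,2,\dots$, where $Z(\lambda,\nu)=\sum_{i=0}^\infty\frac{\lambda^i}{(i!)^\nu}$. For $\nu>0$, $m\in\{0,1,2,\dots\}$, $p\in(0,1)$, the COM-binomial distribution with parameters $(m,p,\nu)$ has probability mass function $\binom{m}{k}^\nu p^k(1-p)^{m-k}\big/\sum_{i=0}^m\binom{m}{i}^\nu p^i(1-p)^{m-i}$, $k=0,1,\dots,m$. *)

theory Defs
  imports "HOL-Probability.Probability"
begin

definition com_poisson_Z :: "real \<Rightarrow> real \<Rightarrow> real" where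
  "com_poisson_Z lam nu = (\<Sum>i. lam ^ i / fact i powr nu)"

definition com_poisson_mass :: "real \<Rightarrow> real \<Rightarrow> nat \<Rightarrow> real" where
  "com_poisson_mass lam nu k = lam ^ k / fact k powr nu * (1 / com_poisson_Z lam nu)"

definition com_poisson_distributed :: "'a measure \<Rightarrow> ('a \<Rightarrow> nat) \<Rightarrow> real \<Rightarrow> real \<Rightarrow> bool" where
  "com_poisson_distributed M X lam nu \<longleftrightarrow>
     X \<in> M \<rightarrow>\<^sub>M count_space UNIV \<and>
     (\<forall>k. \<P>(\<omega> in M. X \<omega> = k) = com_poisson_mass lam nu k)"

text \<open>For \<open>k > m\<close> the binomial coefficient is 0 and \<open>0 powr nu = 0\<close>, so the mass vanishes
  outside \<open>{0..m}\<close>.\<close>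

definition com_binomial_mass :: "nat \<Rightarrow> real \<Rightarrow> real \<Rightarrow> nat \<Rightarrow> real" where
  "com_binomial_mass m p nu k =
     real (m choose k) powr nu * p ^ k * (1 - p) ^ (m - k) /
     (\<Sum>i=0..m. real (m choose i) powr nu * p ^ i * (1 - p) ^ (m - i))"

text \<open>The normalising series converges for all admissible parameters, so that
  \<^const>\<open>com_poisson_Z\<close> is a genuine infinite sum.\<close>

lemma summable_com_poisson:
  fixes lam nu :: real
  assumes "lam > 0" "nu > 0"
  shows "summable (\<lambda>i::nat. lam ^ i / fact i powr nu)"
proof -
  define f where "f = (\<lambda>i::nat. lam ^ i / (fact i :: real) powr nu)"
  have step: "f (Suc n) = lam * real (Suc n) powr (-nu) * f n" for n
  proof -
    have "fact (Suc n) powr nu = real (Suc n) powr nu * (fact n :: real) powr nu"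
      by (simp add: powr_mult del: of_nat_Suc)
    then show ?thesis
      by (simp add: f_def powr_minus field_simps del: of_nat_Suc fact_Suc)
  qed
  have "filterlim (\<lambda>n. real (Suc n)) at_top sequentially"
    by (rule filterlim_compose[OF filterlim_real_sequentially filterlim_Suc])
  with assms(2) have "(\<lambda>n. real (Suc n) powr (-nu)) \<longlonglongrightarrow> 0"
    by (intro tendsto_neg_powr) auto
  then have "(\<lambda>n. lam * real (Suc n) powr (-nu)) \<longlonglongrightarrow> lam * 0"
    by (intro tendsto_mult tendsto_const)
  then have "\<forall>\<^sub>F n in sequentially. lam * real (Suc n) powr (-nu) < 1/2"
    by (intro order_tendstoD(2)[where y = "lam * 0"]) auto
  then obtain N where N: "\<And>n. n \<ge> N \<Longrightarrow> lam * real (Suc n) powr (-nu) < 1/2"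
    unfolding eventually_sequentially by blast
  have f_nonneg: "f n \<ge> 0" for n
    using assms(1) by (simp add: f_def)
  have "summable f"
  proof (rule summable_ratio_test[of "1/2" N])
    fix n assume "n \<ge> N"
    then have "f (Suc n) \<le> 1/2 * f n"
      unfolding step using N[of n] f_nonneg[of n] by (intro mult_right_mono) auto
    then show "norm (f (Suc n)) \<le> 1/2 * norm (f n)"
      using f_nonneg[of n] f_nonneg[of "Suc n"] by simp
  qed simp
  then show ?thesis by (simp add: f_def)
qed

end

theory Submission
  imports Defs
begin

text \<open>Write \<open>p = 1/(\<theta> + 1)\<close> and \<open>q = 1 - p = \<theta> p\<close>. By independence
  \<open>P(X = x | X + Y = n)\<close> is \<open>f(x) g(y) / P(X + Y = n)\<close> for \<open>n = x + y\<close>, and the binomial coefficient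
  factors as \<open>n!/(x! y!)\<close>. Hence the hypothesis says that, after the rescaling
  \<open>F(x) = f(x) (x!)^nu / p^x\<close> and \<open>G(y) = g(y) (y!)^nu / q^y\<close>, the product \<open>F(x) G(y)\<close> is a
  function of \<open>x + y\<close> alone; the normalising sum of the COM-binomial law and \<open>P(X + Y = n)\<close> are
  absorbed in that function. This is a discrete Cauchy equation, whose positive solutions are
  geometric with a common ratio \<open>r\<close> (\<open>geometric_if_product_depends_on_sum\<close>). Therefore
  \<open>f(x)\<close> is proportional to \<open>(p r)^x / (x!)^nu\<close> and \<open>g(y)\<close> to \<open>(\<theta> p r)^y / (y!)^nu\<close>. Total mass
  \<open>1\<close> determines the two constants (\<open>com_poisson_distributed_if_proportional\<close>), so
  \<open>lam = p r\<close>.\<close>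

text \<open>Moving one unit from one argument to the other leaves \<open>x + y\<close> unchanged, so
  \<open>F (x + 1) / F x = G (y + 1) / G y\<close> for all \<open>x\<close> and \<open>y\<close>; both ratios are thus constant
  and equal.\<close>

lemma geometric_if_product_depends_on_sum:
  fixes F G H :: "nat \<Rightarrow> real"
  assumes F_pos: "\<And>n. F n > 0" and G_pos: "\<And>n. G n > 0"
    and prod: "\<And>x y. F x * G y = H (x + y)"
  obtains r where "r > 0" "\<And>n. F n = F 0 * r ^ n" "\<And>n. G n = G 0 * r ^ n"
proof -
  define r where "r = G 1 / G 0"
  have shift: "F (Suc x) * G y = F x * G (Suc y)" for x y
    using prod[of "Suc x" y] prod[of x "Suc y"] by simp
  have F_Suc: "F (Suc n) = r * F n" for n
    using shift[of n 0] G_pos[of 0] by (simp add: r_def field_simps)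
  have G_Suc: "G (Suc n) = r * G n" for n
    using shift[of 0 n] F_pos[of 0] by (simp add: F_Suc)
  show thesis
  proof
    show "r > 0"
      using G_pos by (simp add: r_def)
    show "F n = F 0 * r ^ n" for n
      by (induction n) (simp_all add: F_Suc)
    show "G n = G 0 * r ^ n" for n
      by (induction n) (simp_all add: G_Suc)
  qed
qed

lemma com_poisson_distributed_if_proportional:
  fixes lam nu c :: real and X :: "'a \<Rightarrow> nat"
  assumes "prob_space M" and X: "X \<in> M \<rightarrow>\<^sub>M count_space UNIV"
    and "lam > 0" "nu > 0"
    and mass: "\<And>k. \<P>(\<omega> in M. X \<omega> = k) = c * (lam ^ k / fact k powr nu)"
  shows "com_poisson_distributed M X lam nu"
proof -
  interpret prob_space M by fact
  note X[measurable]
  have "(\<lambda>k. \<P>(\<omega> in M. X \<omega> = k)) sums prob (\<Union>k. {\<omega> \<in> space M. X \<omega> = k})"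
    by (rule finite_measure_UNION) (auto simp: disjoint_family_on_def)
  moreover have "(\<Union>k. {\<omega> \<in> space M. X \<omega> = k}) = space M"
    by auto
  ultimately have "(\<lambda>k. c * (lam ^ k / fact k powr nu)) sums 1"
    by (simp add: mass prob_space)
  moreover have "(\<lambda>k. c * (lam ^ k / fact k powr nu)) sums (c * com_poisson_Z lam nu)"
    unfolding com_poisson_Z_def
    by (intro sums_mult summable_sums summable_com_poisson assms)
  ultimately have "c * com_poisson_Z lam nu = 1"
    by (rule sums_unique2[symmetric])
  then have "c = 1 / com_poisson_Z lam nu"
    by (metis eq_divide_imp mult_zero_right zero_neq_one)
  then show ?thesis
    by (simp add: com_poisson_distributed_def com_poisson_mass_def X mass)
qed

text \<open>Once the factors belonging to \<open>x\<close> and to \<open>y\<close> are divided out, only a function of the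
  number of trials is left. This is what turns the hypothesis on conditional laws into a Cauchy
  equation.\<close>

lemma com_binomial_mass_rescaled:
  fixes p nu :: real
  assumes "0 < p" "p < 1"
  shows "com_binomial_mass (x + y) p nu x * (fact x powr nu / p ^ x) * (fact y powr nu / (1 - p) ^ y)
    = fact (x + y) powr nu /
      (\<Sum>i=0..x + y. real (x + y choose i) powr nu * p ^ i * (1 - p) ^ (x + y - i))"
proof -
  have "real (x + y choose x) = fact (x + y) / (fact x * fact y)"
    by (simp add: binomial_fact)
  then have "real (x + y choose x) powr nu = fact (x + y) powr nu / (fact x powr nu * fact y powr nu)"
    by (simp add: powr_divide powr_mult)
  then show ?thesis
    using assms by (simp add: com_binomial_mass_def)
qed

theorem theorem2p1:
  fixes nu \<theta> :: real and M :: "'a measure" and X Y :: "'a \<Rightarrow> nat"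
  assumes "nu > 0" and "\<theta> > 0"
    and "prob_space M"
    and "prob_space.indep_var M (count_space UNIV) X (count_space UNIV) Y"
    and "\<And>x. \<P>(\<omega> in M. X \<omega> = x) > 0"
    and "\<And>y. \<P>(\<omega> in M. Y \<omega> = y) > 0"
    and "\<And>x y. \<P>(\<omega> in M. X \<omega> = x \<bar> X \<omega> + Y \<omega> = x + y)
                 = com_binomial_mass (x + y) (1 / (\<theta> + 1)) nu x"
  shows "\<exists>lam>0. com_poisson_distributed M X lam nu \<and> com_poisson_distributed M Y (\<theta> * lam) nu"
proof -
  interpret prob_space M by fact
  note indep = assms(4)
  have X [measurable]: "X \<in> M \<rightarrow>\<^sub>M count_space UNIV"
    using indep by (rule indep_var_rv1)
  have Y [measurable]: "Y \<in> M \<rightarrow>\<^sub>M count_space UNIV"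
    using indep by (rule indep_var_rv2)
  define f where "f x = \<P>(\<omega> in M. X \<omega> = x)" for x
  define g where "g y = \<P>(\<omega> in M. Y \<omega> = y)" for y
  define h where "h n = \<P>(\<omega> in M. X \<omega> + Y \<omega> = n)" for n
  have f_pos: "f x > 0" and g_pos: "g y > 0" for x y
    using assms(5,6) by (simp_all add: f_def g_def)
  define p where "p = 1 / (\<theta> + 1)"
  have p: "0 < p" "p < 1" and q: "1 - p = \<theta> * p"
    using \<open>\<theta> > 0\<close> by (simp_all add: p_def field_simps)

  have fg: "f x * g y = h (x + y) * com_binomial_mass (x + y) p nu x" for x y
  proof -
    have "\<P>(\<omega> in M. X \<omega> = x \<and> Y \<omega> = y) = f x * g y"
      using indep_varD[OF indep, of "{x}" "{y}"]
      by (simp add: f_def g_def vimage_def Int_def conj_commute)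
    moreover have "{\<omega> \<in> space M. X \<omega> = x \<and> X \<omega> + Y \<omega> = x + y}
        = {\<omega> \<in> space M. X \<omega> = x \<and> Y \<omega> = y}"
      by auto
    ultimately have joint: "\<P>(\<omega> in M. X \<omega> = x \<and> X \<omega> + Y \<omega> = x + y) = f x * g y"
      by simp
    \<comment> \<open>The conditional probability is a genuine quotient only if \<open>P(X + Y = x + y) > 0\<close>.\<close>
    have "0 < f x * g y"
      using f_pos g_pos by simp
    also have "\<dots> \<le> h (x + y)"
      unfolding joint[symmetric] h_def by (intro finite_measure_mono) auto
    finally show ?thesis
      using assms(7)[of x y, folded p_def]
      by (simp add: cond_prob_def joint h_def[symmetric] field_simps)
  qed

  define F where "F x = f x * (fact x powr nu / p ^ x)" for x
  define G where "G y = g y * (fact y powr nu / (1 - p) ^ y)" for y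
  have prod: "F x * G y = h (x + y) * (fact (x + y) powr nu /
      (\<Sum>i=0..x + y. real (x + y choose i) powr nu * p ^ i * (1 - p) ^ (x + y - i)))" for x y
  proof -
    have "F x * G y = (f x * g y) * ((fact x powr nu / p ^ x) * (fact y powr nu / (1 - p) ^ y))"
      by (simp add: F_def G_def)
    also have "\<dots> = h (x + y) * (com_binomial_mass (x + y) p nu x
        * (fact x powr nu / p ^ x) * (fact y powr nu / (1 - p) ^ y))"
      by (simp only: fg mult.assoc)
    finally show ?thesis
      by (simp only: com_binomial_mass_rescaled[OF p])
  qed
  have F_pos: "F n > 0" and G_pos: "G n > 0" for n
    using f_pos g_pos p by (simp_all add: F_def G_def)
  obtain r where r: "r > 0" and F_geo: "\<And>n. F n = F 0 * r ^ n" and G_geo: "\<And>n. G n = G 0 * r ^ n"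
    using geometric_if_product_depends_on_sum[of F G, OF F_pos G_pos prod] by blast

  have f_eq: "\<P>(\<omega> in M. X \<omega> = k) = F 0 * ((p * r) ^ k / fact k powr nu)" for k
  proof -
    have "f k = F k * (p ^ k / fact k powr nu)"
      using p by (simp add: F_def)
    also have "\<dots> = F 0 * ((p * r) ^ k / fact k powr nu)"
      by (subst F_geo) (simp add: power_mult_distrib)
    finally show ?thesis
      by (simp only: f_def)
  qed
  have g_eq: "\<P>(\<omega> in M. Y \<omega> = k) = G 0 * ((\<theta> * (p * r)) ^ k / fact k powr nu)" for k
  proof -
    have "g k = G k * ((1 - p) ^ k / fact k powr nu)"
      using p by (simp add: G_def)
    also have "\<dots> = G 0 * ((\<theta> * (p * r)) ^ k / fact k powr nu)"
      unfolding q by (subst G_geo) (simp add: power_mult_distrib)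
    finally show ?thesis
      by (simp only: g_def)
  qed
  have lam: "p * r > 0" "\<theta> * (p * r) > 0"
    using p r \<open>\<theta> > 0\<close> by simp_all
  show ?thesis
    using lam(1)
      com_poisson_distributed_if_proportional[OF \<open>prob_space M\<close> X lam(1) \<open>nu > 0\<close> f_eq]
      com_poisson_distributed_if_proportional[OF \<open>prob_space M\<close> Y lam(2) \<open>nu > 0\<close> g_eq]
    by blast
qed

end
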